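(* There exist infinitely many $\mathrm{GL}_2(\mathbb{Z})$-classes of primitive ordinary integral binary quadratic forms whose discriminant is congruent to $5\pmod 8$.
   Context: A form $aX^2+bXY+cY^2$ with $a,b,c\in\mathbb{Z}$ is primitive if $\gcd(a,b,c)=1$; its discriminant is $b^2-4ac$. $\mathrm{GL}_2(\mathbb{Z})$ acts by linear substitution, and the orbit of $F$ is $[F]_{\mathrm{GL}_2(\mathbb{Z})}$. Let $[F]_{\mathrm{val}}$ be the set of integral forms $G$ with $G(\mathbb{Z}^2)=F(\mathbb{Z}^2)$. The form $F$ is ordinary if $[F]_{\mathrm{val}}=[F]_{\mathrm{GL}_2(\mathbb{Z})}$. *)

theory Defs
  imports "HOL-Analysis.Determinants" "HOL-Number_Theory.Cong"
begin

text \<open>The form with coefficients \<open>a\<close>, \<open>b\<close>, \<open>c\<close> is \<open>a X^2 + b X Y + c Y^2\<close>.\<close>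

datatype bqf = Bqf (coeff_a: int) (coeff_b: int) (coeff_c: int)

definition bqf_eval :: "bqf \<Rightarrow> int ^ 2 \<Rightarrow> int" where
  "bqf_eval F v =
     coeff_a F * (v $ 1)\<^sup>2 + coeff_b F * (v $ 1) * (v $ 2) + coeff_c F * (v $ 2)\<^sup>2"

definition bqf_primitive :: "bqf \<Rightarrow> bool" where
  "bqf_primitive F \<longleftrightarrow> Gcd {coeff_a F, coeff_b F, coeff_c F} = 1"

definition bqf_discr :: "bqf \<Rightarrow> int" where
  "bqf_discr F = (coeff_b F)\<^sup>2 - 4 * coeff_a F * coeff_c F"

definition GL2_Z :: "(int ^ 2 ^ 2) set" where
  "GL2_Z = {M. invertible M}"

text \<open>
  The coefficients of \<open>F (p X + q Y, r X + s Y)\<close>, where \<open>M\<close> has rows \<open>(p, q)\<close> and \<open>(r, s)\<close>.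
\<close>

definition bqf_subst :: "bqf \<Rightarrow> int ^ 2 ^ 2 \<Rightarrow> bqf" where
  "bqf_subst F M =
     (let a = coeff_a F; b = coeff_b F; c = coeff_c F;
          p = M $ 1 $ 1; q = M $ 1 $ 2; r = M $ 2 $ 1; s = M $ 2 $ 2
      in Bqf (a * p\<^sup>2 + b * p * r + c * r\<^sup>2)
             (2 * a * p * q + b * (p * s + q * r) + 2 * c * r * s)
             (a * q\<^sup>2 + b * q * s + c * s\<^sup>2))"

lemma bqf_eval_subst: "bqf_eval (bqf_subst F M) v = bqf_eval F (M *v v)"
  by (simp add: bqf_eval_def bqf_subst_def matrix_vector_mult_def sum_2 Let_def
      power2_eq_square algebra_simps)

definition GL2_class :: "bqf \<Rightarrow> bqf set" where
  "GL2_class F = bqf_subst F ` GL2_Z"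

definition val_class :: "bqf \<Rightarrow> bqf set" where
  "val_class F = {G. range (bqf_eval G) = range (bqf_eval F)}"

definition ordinary :: "bqf \<Rightarrow> bool" where
  "ordinary F \<longleftrightarrow> val_class F = GL2_class F"

end

theory Submission imports Defs begin

text \<open>
  The forms \<open>X^2 + X Y + c Y^2\<close> with \<open>c \<equiv> 5 (mod 8)\<close> positive are ordinary.  A form with the same
  values represents 1, hence is equivalent to \<open>X^2 + b X Y + d Y^2\<close> with \<open>b \<in> {0, 1}\<close>.
  The smallest non-square value of \<open>X^2 + X Y + c Y^2\<close> is \<open>c\<close>, and \<open>c + 2\<close> is a further
  non-square value; comparing these with the small values \<open>d\<close>, \<open>d + 1\<close> or \<open>d + 2\<close> of the other
  form forces \<open>b = 1\<close> and \<open>d = c\<close>.  The value \<open>c\<close> also separates the members of the family.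
\<close>

section \<open>Substitution as a group action on forms\<close>

lemma bqf_subst_mult: "bqf_subst (bqf_subst F A) B = bqf_subst F (A ** B)"
  by (simp add: bqf_subst_def matrix_matrix_mult_def sum_2 Let_def power2_eq_square algebra_simps)

lemma bqf_subst_one: "bqf_subst F (mat 1) = F"
  by (cases F) (simp add: bqf_subst_def mat_def Let_def)

lemma range_bqf_eval_Bqf:
  "range (bqf_eval (Bqf a b c)) = {a * x\<^sup>2 + b * x * y + c * y\<^sup>2 | x y. True}"
proof (intro equalityI subsetI)
  fix n assume "n \<in> {a * x\<^sup>2 + b * x * y + c * y\<^sup>2 | x y. True}"
  then obtain x y where "n = a * x\<^sup>2 + b * x * y + c * y\<^sup>2"
    by blast
  then have "n = bqf_eval (Bqf a b c) (vector [x, y])"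
    by (simp add: bqf_eval_def)
  then show "n \<in> range (bqf_eval (Bqf a b c))"
    by blast
qed (auto simp: bqf_eval_def)

lemma range_bqf_eval_subst:
  assumes "M \<in> GL2_Z"
  shows "range (bqf_eval (bqf_subst F M)) = range (bqf_eval F)"
proof -
  obtain N where N: "M ** N = mat 1"
    using assms by (auto simp: GL2_Z_def invertible_def)
  have "bqf_eval F v = bqf_eval (bqf_subst F M) (N *v v)" for v
    by (simp add: bqf_eval_subst matrix_vector_mul_assoc N)
  then show ?thesis
    by (auto simp: bqf_eval_subst)
qed

text \<open>This inclusion holds for every form, so ordinarity amounts to the reverse one.\<close>

lemma GL2_class_subset_val_class: "GL2_class F \<subseteq> val_class F"
  unfolding GL2_class_def val_class_def using range_bqf_eval_subst by blast

lemma mem_GL2_class_self: "F \<in> GL2_class F"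
proof -
  have "mat 1 \<in> GL2_Z"
    by (auto simp: GL2_Z_def invertible_def)
  then show ?thesis
    unfolding GL2_class_def by (metis bqf_subst_one image_eqI)
qed

lemma mem_GL2_class_subst:
  assumes "M \<in> GL2_Z"
  shows "F \<in> GL2_class (bqf_subst F M)"
proof -
  obtain N where N: "M ** N = mat 1" "N ** M = mat 1"
    using assms by (auto simp: GL2_Z_def invertible_def)
  then have "N \<in> GL2_Z"
    by (auto simp: GL2_Z_def invertible_def)
  moreover have "F = bqf_subst (bqf_subst F M) N"
    by (simp add: bqf_subst_mult N bqf_subst_one)
  ultimately show ?thesis
    unfolding GL2_class_def by blast
qed

lemma GL2_Z_of_det_one:
  fixes p q r s :: int
  assumes "p * s - q * r = 1"
  shows "vector [vector [p, q], vector [r, s]] \<in> GL2_Z"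
proof -
  let ?M = "vector [vector [p, q], vector [r, s]] :: int ^ 2 ^ 2"
  let ?N = "vector [vector [s, - q], vector [- r, p]] :: int ^ 2 ^ 2"
  have "?M ** ?N = mat 1" "?N ** ?M = mat 1"
    using assms
    by (simp_all add: matrix_matrix_mult_def mat_def vec_eq_iff forall_2 sum_2 algebra_simps)
  then show ?thesis
    by (auto simp: GL2_Z_def invertible_def)
qed

text \<open>A vector with value 1 has coprime entries, so Bezout completes it to the first column of
  a matrix of determinant 1. Adding \<open>k\<close> times that column to the second one shifts the
  middle coefficient by \<open>2 * k\<close>, which reduces it modulo 2.\<close>

lemma represents_one_normal_form:
  assumes "1 \<in> range (bqf_eval G)"
  obtains M b c where "M \<in> GL2_Z" "bqf_subst G M = Bqf 1 b c" "b = 0 \<or> b = 1"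
proof -
  obtain A B C where G: "G = Bqf A B C" by (cases G)
  obtain p r where pr: "A * p\<^sup>2 + B * p * r + C * r\<^sup>2 = 1"
    using assms unfolding G range_bqf_eval_Bqf by auto
  have "gcd p r dvd A * p\<^sup>2 + B * p * r + C * r\<^sup>2"
    by (simp add: power2_eq_square)
  then have "gcd p r = 1"
    using pr by simp
  then obtain s q' where "s * p + q' * r = 1"
    using bezout_int[of p r] by auto
  then have det: "p * s - (- q') * r = 1"
    by (simp add: algebra_simps)
  define q where "q = - q'"
  define \<beta> where "\<beta> = 2 * A * p * q + B * (p * s + q * r) + 2 * C * r * s"
  define k where "k = - (\<beta> div 2)"
  define M :: "int ^ 2 ^ 2" where "M = vector [vector [p, q + k * p], vector [r, s + k * r]]"
  have "M \<in> GL2_Z"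
    unfolding M_def by (rule GL2_Z_of_det_one) (use det in \<open>simp add: q_def algebra_simps\<close>)
  moreover have "coeff_a (bqf_subst G M) = 1"
    using pr by (simp add: G M_def bqf_subst_def Let_def)
  moreover have "coeff_b (bqf_subst G M) = \<beta> mod 2"
  proof -
    have "coeff_b (bqf_subst G M) = \<beta> + 2 * k * (A * p\<^sup>2 + B * p * r + C * r\<^sup>2)"
      by (simp add: G M_def bqf_subst_def Let_def \<beta>_def power2_eq_square algebra_simps)
    then show ?thesis
      by (simp add: pr k_def minus_mult_div_eq_mod)
  qed
  ultimately show thesis
    by (intro that[of M "\<beta> mod 2" "coeff_c (bqf_subst G M)"]) (auto simp: bqf.expand)
qed

section \<open>Squares modulo 8 and lower bounds for values\<close>

lemma square_mod_8: "(x::int)\<^sup>2 mod 8 \<in> {0, 1, 4}"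
proof -
  have "x mod 8 \<in> {0..<8}"
    by simp
  also have "{0..<8} = {0, 1, 2, 3, 4, 5, 6, 7 :: int}"
    by auto
  finally have "x mod 8 \<in> {0, 1, 2, 3, 4, 5, 6, 7}" .
  then have "(x mod 8)\<^sup>2 mod 8 \<in> {0, 1, 4}"
    by auto
  then show ?thesis
    by (simp add: power_mod)
qed

text \<open>These residues avoid 5 and those of squares: two squares never differ by 2, and
  \<open>c\<close> is not 2 more than a square.\<close>

lemma square_add_2_mod_8: "((x::int)\<^sup>2 + 2) mod 8 \<in> {2, 3, 6}"
  using square_mod_8[of x] mod_add_left_eq[of "x\<^sup>2" 8 2] by auto

lemma principal_form_lower_bound:
  fixes c x y :: int
  assumes "c \<ge> 1"
  shows "(4 * c - 1) * y\<^sup>2 \<le> 4 * (x\<^sup>2 + x * y + c * y\<^sup>2)"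
proof -
  have "4 * (x\<^sup>2 + x * y + c * y\<^sup>2) = (2 * x + y)\<^sup>2 + (4 * c - 1) * y\<^sup>2"
    by (simp add: power2_eq_square algebra_simps)
  then show ?thesis by simp
qed

lemma int_square_ge_1: "(y::int) \<noteq> 0 \<Longrightarrow> y\<^sup>2 \<ge> 1"
  by (smt (verit) zero_less_power2)

lemma int_square_ge_4:
  assumes "(y::int) \<noteq> 0" "y \<noteq> 1" "y \<noteq> - 1"
  shows "y\<^sup>2 \<ge> 4"
proof -
  have "2\<^sup>2 \<le> \<bar>y\<bar>\<^sup>2"
    by (rule power_mono) (use assms in auto)
  then show ?thesis by simp
qed

text \<open>A nonsquare value needs \<open>y\<close> nonzero, so four times the value is at least
  \<open>4 * c - 1\<close>; integrality rounds this up to \<open>4 * c\<close>.\<close>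

lemma principal_form_nonsquare_ge:
  fixes c x y :: int
  assumes "c \<ge> 1" and ns: "\<And>m. x\<^sup>2 + x * y + c * y\<^sup>2 \<noteq> m\<^sup>2"
  shows "x\<^sup>2 + x * y + c * y\<^sup>2 \<ge> c"
proof -
  have "y \<noteq> 0"
    using ns[of x] by auto
  then have "(4 * c - 1) * 1 \<le> (4 * c - 1) * y\<^sup>2"
    using assms(1) by (intro mult_left_mono int_square_ge_1) auto
  also note principal_form_lower_bound[OF assms(1), of y x]
  finally have "4 * (c - (x\<^sup>2 + x * y + c * y\<^sup>2)) \<le> 1"
    by (simp add: right_diff_distrib)
  then have "c - (x\<^sup>2 + x * y + c * y\<^sup>2) \<le> 0"
    by presburger
  then show ?thesis by simp
qed

section \<open>Recovering the form from its values\<close>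

lemma value_set_determines_principal_form:
  fixes b c d :: int
  assumes c: "c > 0" "c mod 8 = 5" and b: "b = 0 \<or> b = 1"
    and eq: "range (bqf_eval (Bqf 1 b d)) = range (bqf_eval (Bqf 1 1 c))"
  shows "b = 1 \<and> d = c"
proof -
  have toF: "\<exists>u v. x\<^sup>2 + b * x * y + d * y\<^sup>2 = u\<^sup>2 + u * v + c * v\<^sup>2" for x y
  proof -
    have "x\<^sup>2 + b * x * y + d * y\<^sup>2 \<in> range (bqf_eval (Bqf 1 b d))"
      unfolding range_bqf_eval_Bqf by auto
    then show ?thesis unfolding eq unfolding range_bqf_eval_Bqf by auto
  qed
  have toG: "\<exists>u v. x\<^sup>2 + x * y + c * y\<^sup>2 = u\<^sup>2 + b * u * v + d * v\<^sup>2" for x y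
  proof -
    have "x\<^sup>2 + x * y + c * y\<^sup>2 \<in> range (bqf_eval (Bqf 1 1 c))"
      unfolding range_bqf_eval_Bqf by auto
    then show ?thesis unfolding eq[symmetric] unfolding range_bqf_eval_Bqf by auto
  qed
  have c5: "c \<ge> 5" using c by presburger
  have ns0: "c \<noteq> m\<^sup>2" for m
    using square_mod_8[of m] c(2) by force
  have ns2': "c \<noteq> m\<^sup>2 + 2" for m
    using square_add_2_mod_8[of m] c(2) by force
  have "(c + 2) mod 8 = 7"
    using c(2) by presburger
  then have ns2: "c + 2 \<noteq> m\<^sup>2" for m
    using square_mod_8[of m] by force
  have nonneg: "x\<^sup>2 + b * x * y + d * y\<^sup>2 \<ge> 0" for x y
  proof -
    obtain u v where uv: "x\<^sup>2 + b * x * y + d * y\<^sup>2 = u\<^sup>2 + u * v + c * v\<^sup>2"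
      using toF by blast
    have "0 \<le> (4 * c - 1) * v\<^sup>2" using c by auto
    also have "\<dots> \<le> 4 * (u\<^sup>2 + u * v + c * v\<^sup>2)"
      using c by (intro principal_form_lower_bound) auto
    finally show ?thesis using uv by simp
  qed
  have min: "x\<^sup>2 + b * x * y + d * y\<^sup>2 \<ge> c"
    if "\<And>m. x\<^sup>2 + b * x * y + d * y\<^sup>2 \<noteq> m\<^sup>2" for x y
  proof -
    obtain u v where uv: "x\<^sup>2 + b * x * y + d * y\<^sup>2 = u\<^sup>2 + u * v + c * v\<^sup>2"
      using toF by blast
    then show ?thesis
      using principal_form_nonsquare_ge[of c u v] that c by auto
  qed
  obtain u v where uv: "c = u\<^sup>2 + b * u * v + d * v\<^sup>2"
    using toG[of 0 1] by auto
  obtain u' v' where uv': "c + 2 = u'\<^sup>2 + b * u' * v' + d * v'\<^sup>2"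
    using toG[of 1 1] by (auto simp: add.commute)
  have v0: "v \<noteq> 0" "v' \<noteq> 0"
    using uv uv' ns0[of u] ns2[of u'] by auto
  have d_ge: "d \<ge> 0" using nonneg[of 0 1] by simp
  have d_cases: "d \<ge> c \<or> (\<exists>m. d = m\<^sup>2)"
    using min[of 0 1] by auto
  show ?thesis
  proof (cases "b = 0")
    case True
    have "d * 1 \<le> d * v\<^sup>2"
      using d_ge v0 by (intro mult_left_mono int_square_ge_1) auto
    then have "d \<le> c"
      using uv True by (simp add: add_increasing)
    have "d \<noteq> 0"
      using uv True ns0[of u] by auto
    \<comment> \<open>Together with \<open>c \<le> d + 1\<close> this would give
      \<open>d \<le> 1\<close>, against \<open>c \<ge> 5\<close>.\<close>
    have ge4: "d * 4 \<le> c + 2" if "v' \<noteq> 1" "v' \<noteq> - 1"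
    proof -
      have "d * 4 \<le> d * v'\<^sup>2"
        using d_ge v0 that by (intro mult_left_mono int_square_ge_4) auto
      then show ?thesis
        using uv' True by (simp add: add_increasing)
    qed
    have c_le: "c \<le> d + 1"
    proof (cases "d = c")
      case False
      then obtain m where m: "d = m\<^sup>2" using d_cases \<open>d \<le> c\<close> by auto
      \<comment> \<open>Consecutive integers are both squares only for 0 and 1, and \<open>d\<close>
        is nonzero. So the value \<open>d + 1\<close> at (1, 1) is a nonsquare, hence at least
        \<open>c\<close>.\<close>
      have "d + 1 \<noteq> n\<^sup>2" for n
      proof
        assume n: "d + 1 = n\<^sup>2"
        have "\<bar>m\<bar>\<^sup>2 < \<bar>n\<bar>\<^sup>2" using n m by simp
        then have "\<bar>m\<bar> + 1 \<le> \<bar>n\<bar>"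
          using power2_less_imp_less[of "\<bar>m\<bar>" "\<bar>n\<bar>"] by linarith
        then have "(\<bar>m\<bar> + 1)\<^sup>2 \<le> \<bar>n\<bar>\<^sup>2" by (intro power_mono) auto
        then have "m\<^sup>2 + 2 * \<bar>m\<bar> + 1 \<le> n\<^sup>2" by (simp add: power2_sum)
        then show False using n m \<open>d \<noteq> 0\<close> by auto
      qed
      then show ?thesis using min[of 1 1] True by (simp add: add.commute)
    qed simp
    have "v' = 1 \<or> v' = - 1"
      using ge4 c_le c5 by linarith
    then have "u'\<^sup>2 = c + 2 - d" using uv' True by auto
    \<comment> \<open>The difference \<open>c - d\<close> is 0 or 1.\<close>
    then have "u'\<^sup>2 = 2 \<or> u'\<^sup>2 = 3" using c_le \<open>d \<le> c\<close> by linarith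
    then have False using square_mod_8[of u'] by auto
    then show ?thesis ..
  next
    case False
    with b have b1: "b = 1" by simp
    have "d \<noteq> 0"
      \<comment> \<open>The value at (1, -2) is \<open>4 * d - 1\<close>, negative for
        \<open>d = 0\<close>.\<close>
      using nonneg[of 1 "-2"] b1 by auto
    then have d1: "d \<ge> 1" using d_ge by simp
    \<comment> \<open>The bound on nonsquare values is now applied to the other form, which takes
      the nonsquare value \<open>c\<close>.\<close>
    have "d \<le> c"
      using principal_form_nonsquare_ge[of d u v] uv b1 d1 ns0 by auto
    have "d = c"
    proof (rule ccontr)
      assume "d \<noteq> c"
      then obtain m where m: "d = m\<^sup>2" using d_cases \<open>d \<le> c\<close> by auto
      \<comment> \<open>For \<open>b = 1\<close> the value at (1, 1) is \<open>d + 2\<close>. Being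
        a nonsquare it is at least \<open>c\<close>, and \<open>c = d + 2\<close> is excluded modulo
        8, which leaves \<open>c = d + 1\<close>.\<close>
      have "d + 2 \<noteq> n\<^sup>2" for n
        using square_add_2_mod_8[of m] square_mod_8[of n] m by force
      then have "c \<le> d + 2" using min[of 1 1] b1 by (simp add: add.commute)
      then have cd: "c = d + 1"
        using \<open>d \<noteq> c\<close> \<open>d \<le> c\<close> ns2'[of m] m by auto
      have "v = 1 \<or> v = - 1"
      proof (rule ccontr)
        assume "\<not> (v = 1 \<or> v = - 1)"
        \<comment> \<open>Otherwise \<open>4 * (4 * d - 1) \<le> 4 * c = 4 * d + 4\<close>,
          impossible for \<open>d \<ge> 1\<close>.\<close>
        then have "(4 * d - 1) * 4 \<le> (4 * d - 1) * v\<^sup>2"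
          using d1 v0 by (intro mult_left_mono int_square_ge_4) auto
        then show False
          using principal_form_lower_bound[of d v u] uv b1 cd d1 c5 by simp
      qed
      then have "u\<^sup>2 + u * v = 1" using uv b1 cd by auto
      \<comment> \<open>With \<open>v\<close> equal to 1 or -1 this is a product of two consecutive
        integers.\<close>
      moreover have "even (u\<^sup>2 + u * v)"
        using \<open>v = 1 \<or> v = - 1\<close> by auto
      ultimately show False by simp
    qed
    then show ?thesis using b1 by simp
  qed
qed

lemma ordinary_principal_form:
  assumes "c > 0" "c mod 8 = 5"
  shows "ordinary (Bqf 1 1 c)"
proof -
  have "G \<in> GL2_class (Bqf 1 1 c)" if "G \<in> val_class (Bqf 1 1 c)" for G
  proof -
    have G: "range (bqf_eval G) = range (bqf_eval (Bqf 1 1 c))"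
      using that by (simp add: val_class_def)
    have "1 = 1 * 1\<^sup>2 + 1 * 1 * 0 + c * 0\<^sup>2" by simp
    then have "1 \<in> range (bqf_eval G)"
      unfolding G range_bqf_eval_Bqf by blast
    then obtain M b d where M: "M \<in> GL2_Z" "bqf_subst G M = Bqf 1 b d" "b = 0 \<or> b = 1"
      by (rule represents_one_normal_form)
    have "range (bqf_eval (Bqf 1 b d)) = range (bqf_eval (Bqf 1 1 c))"
      using range_bqf_eval_subst[OF M(1), of G] M(2) G by simp
    then have "b = 1 \<and> d = c"
      by (rule value_set_determines_principal_form[OF assms M(3)])
    then show ?thesis
      using mem_GL2_class_subst[OF M(1), of G] M(2) by simp
  qed
  then show ?thesis
    unfolding ordinary_def using GL2_class_subset_val_class by blast
qed

theorem theorem1p14: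
  "infinite {GL2_class F | F. bqf_primitive F \<and> ordinary F \<and> [bqf_discr F = 5] (mod 8)}"
proof -
  \<comment> \<open>The discriminant is \<open>-19 - 32 * n\<close>, congruent to 5 modulo
    8.\<close>
  define F where "F n = Bqf 1 1 (8 * int n + 5)" for n
  have "inj (\<lambda>n. GL2_class (F n))"
  proof (rule injI)
    fix i j
    assume "GL2_class (F i) = GL2_class (F j)"
    then have "F i \<in> val_class (F j)"
      using mem_GL2_class_self GL2_class_subset_val_class by blast
    then have "range (bqf_eval (F i)) = range (bqf_eval (F j))"
      by (simp add: val_class_def)
    \<comment> \<open>Both forms lie in the family, so the case \<open>b = 1\<close> of the
      comparison of value sets equates their last coefficients.\<close>
    then have "8 * int i + 5 = 8 * int j + 5"
      unfolding F_def by (rule value_set_determines_principal_form[THEN conjunct2, rotated 3]) auto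
    then show "i = j" by simp
  qed
  then have "infinite (range (\<lambda>n. GL2_class (F n)))"
    by (rule range_inj_infinite)
  moreover have "bqf_primitive (F n)" "ordinary (F n)" "[bqf_discr (F n) = 5] (mod 8)" for n
  proof -
    show "bqf_primitive (F n)"
      by (simp add: bqf_primitive_def F_def)
    show "ordinary (F n)"
      unfolding F_def by (rule ordinary_principal_form) auto
    show "[bqf_discr (F n) = 5] (mod 8)"
      by (simp add: bqf_discr_def F_def cong_iff_dvd_diff)
  qed
  ultimately show ?thesis
    by (elim infinite_super[rotated]) blast
qed

end
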